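(* Let $a>0$, $0<\beta<2$, $c_1,c_2>0$ and $t=c_2/c_1$. For $k\in\mathbb N$ let $w_k=w(k)$ and $v_k=w(k+1-\beta)$, where $$w(x)=\frac{\Gamma(\beta)\,a^x}{\Gamma(\beta+x)\,\Gamma(x+1)}.$$ Let $(R_n)_{n\ge0}$ be the monic orthogonal polynomials ($\deg R_n=n$) on the bi-lattice $\mathbb N\cup(\mathbb N+1-\beta)$ satisfying $$c_1\sum_{k=0}^\infty R_n(k)R_m(k)\,w_k+c_2\sum_{k=0}^\infty R_n(k+1-\beta)R_m(k+1-\beta)\,v_k=0,\qquad m\ne n,$$ and let $\tilde a_n^2$ and $\tilde b_n$ be the coefficients in their three-term recurrence relation $$xR_n(x)=R_{n+1}(x)+\tilde b_nR_n(x)+\tilde a_n^2R_{n-1}(x),\qquad n\ge0,$$ with $R_{-1}=0$, $R_0=1$ and $\tilde a_0^2=0$. Then $$\tilde b_n+\tilde b_{n-1}-n+\beta=\frac{an}{\tilde a_n^2}\qquad(n\ge1),$$ $$(\tilde a_{n+1}^2-a)(\tilde a_n^2-a)=a\,(\tilde b_n-n)(\tilde b_n-n+\beta-1)\qquad(n\ge0),$$ with initial conditions $$\tilde a_0^2=0,\qquad \tilde b_0=\sqrt a\,\frac{I_\beta(2\sqrt a)+t\,I_{-\beta}(2\sqrt a)}{I_{\beta-1}(2\sqrt a)+t\,I_{1-\beta}(2\sqrt a)}.$$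
   Context: $\mathbb N=\{0,1,2,\ldots\}$ and $\mathbb N+1-\beta=\{1-\beta,2-\beta,\ldots\}$. Explicitly, $w_k=\frac{a^k}{(\beta)_kk!}$ and $v_k=\frac{\Gamma(\beta)a^{1-\beta}}{\Gamma(2-\beta)}\frac{a^k}{k!(2-\beta)_k}$, where $(x)_k=x(x+1)\cdots(x+k-1)$, $(x)_0=1$. $I_\nu$ is the modified Bessel function $I_\nu(z)=\sum_{k=0}^\infty \frac{(z/2)^{2k+\nu}}{k!\,\Gamma(k+\nu+1)}$ (for $z>0$), where $1/\Gamma$ is taken to be $0$ at the poles of $\Gamma$. *)

theory Defs
  imports "HOL-Analysis.Analysis"
begin

definition weight :: "real \<Rightarrow> real \<Rightarrow> real \<Rightarrow> real" where
  "weight a \<beta> x = Gamma \<beta> * a powr x / (Gamma (\<beta> + x) * Gamma (x + 1))"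

text \<open>
  Modified Bessel function of the first kind, for real order and \<open>z > 0\<close>. The function
  \<open>rGamma\<close> is the reciprocal Gamma function, which is \<open>0\<close> at the poles of \<open>Gamma\<close>.
\<close>
definition bessel_I :: "real \<Rightarrow> real \<Rightarrow> real" where
  "bessel_I \<nu> z = (\<Sum>k. (z / 2) powr (2 * real k + \<nu>) / fact k * rGamma (real k + \<nu> + 1))"

definition bilattice_inner ::
    "real \<Rightarrow> real \<Rightarrow> real \<Rightarrow> real \<Rightarrow> real poly \<Rightarrow> real poly \<Rightarrow> real" where
  "bilattice_inner a \<beta> c\<^sub>1 c\<^sub>2 p q =
     c\<^sub>1 * (\<Sum>k. poly p (real k) * poly q (real k) * weight a \<beta> (real k)) +
     c\<^sub>2 * (\<Sum>k. poly p (real k + 1 - \<beta>) * poly q (real k + 1 - \<beta>) * weight a \<beta> (real k + 1 - \<beta>))"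

definition monic_orthogonal_polys ::
    "real \<Rightarrow> real \<Rightarrow> real \<Rightarrow> real \<Rightarrow> (nat \<Rightarrow> real poly) \<Rightarrow> bool" where
  "monic_orthogonal_polys a \<beta> c\<^sub>1 c\<^sub>2 R \<longleftrightarrow>
     (\<forall>n. degree (R n) = n \<and> lead_coeff (R n) = 1) \<and>
     (\<forall>m n. m \<noteq> n \<longrightarrow> bilattice_inner a \<beta> c\<^sub>1 c\<^sub>2 (R n) (R m) = 0)"

text \<open>
  The sequence \<open>A\<close> holds the squared coefficients \<open>a\<^sub>n\<^sup>2\<close> themselves (not the \<open>a\<^sub>n\<close>). The
  conditional encodes the convention \<open>R\<^sub>-\<^sub>1 = 0\<close>.
\<close>
definition three_term_recurrence ::
    "(nat \<Rightarrow> real poly) \<Rightarrow> (nat \<Rightarrow> real) \<Rightarrow> (nat \<Rightarrow> real) \<Rightarrow> bool" where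
  "three_term_recurrence R A b \<longleftrightarrow>
     A 0 = 0 \<and>
     (\<forall>n. [:0, 1:] * R n =
        R (n + 1) + smult (b n) (R n) + smult (A n) (if n = 0 then 0 else R (n - 1)))"

end

theory Submission
  imports Defs
begin

text \<open>
  Since \<open>x (x + \<beta> - 1) w(x) = a w(x - 1)\<close> and both lattices start at a zero of
  \<open>\<sigma>(x) = x (x + \<beta> - 1)\<close>, the moment functional satisfies the Pearson equation
  \<open>L(\<sigma>(x) p(x)) = a L(p(x + 1))\<close>. Orthogonality then gives the structure relation
  \<open>R\<^sub>n(x + 1) = R\<^sub>n + n R\<^sub>n\<^sub>-\<^sub>1 + g\<^sub>n R\<^sub>n\<^sub>-\<^sub>2\<close> with \<open>g\<^sub>n = A\<^sub>n A\<^sub>n\<^sub>-\<^sub>1 / a\<close>. Evaluating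
  \<open>L(\<sigma> R\<^sub>n(x) R\<^sub>n\<^sub>-\<^sub>1(x - 1))\<close> in two ways yields the first equation. The second one combines it
  with the two evaluations of \<open>L(\<sigma> R\<^sub>n(x) R\<^sub>n(x - 1))\<close> and with
  \<open>g\<^sub>n\<^sub>+\<^sub>1 - g\<^sub>n = n (b\<^sub>n\<^sub>-\<^sub>1 - b\<^sub>n + 1)\<close>. The initial value \<open>b\<^sub>0 = L(x) / L(1)\<close> is read off the
  Bessel series.
\<close>

section \<open>Translates of polynomials and their two top coefficients\<close>

definition shift_poly :: "real \<Rightarrow> real poly \<Rightarrow> real poly" where
  "shift_poly c p = pcompose p [:c, 1:]"

lemma poly_shift_poly [simp]: "poly (shift_poly c p) x = poly p (x + c)"
  by (simp add: shift_poly_def poly_pcompose add.commute)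

lemma shift_poly_add: "shift_poly c (p + q) = shift_poly c p + shift_poly c q"
  and shift_poly_smult: "shift_poly c (smult r p) = smult r (shift_poly c p)"
  and shift_poly_mult: "shift_poly c (p * q) = shift_poly c p * shift_poly c q"
  by (simp_all add: shift_poly_def pcompose_add pcompose_smult pcompose_mult)

lemma shift_poly_shift_poly: "shift_poly c (shift_poly d p) = shift_poly (c + d) p"
  by (rule poly_eq_poly_eq_iff [THEN iffD1]) (auto simp: fun_eq_iff add_ac)

lemma shift_poly_0 [simp]: "shift_poly 0 p = p"
  by (rule poly_eq_poly_eq_iff [THEN iffD1]) (auto simp: fun_eq_iff)

lemma degree_shift_poly [simp]: "degree (shift_poly c p) = degree p"
  by (simp add: shift_poly_def degree_pcompose)

lemma lead_coeff_shift_poly [simp]: "lead_coeff (shift_poly c p) = lead_coeff p"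
  using lead_coeff_comp [of "[:c, 1:]" p] by (simp add: shift_poly_def)

text \<open>Under the degree bound, position \<open>k\<close> receives contributions from degrees
  \<open>k\<close> and \<open>Suc k\<close> alone, the latter with binomial factor
  \<open>Suc k\<close> times \<open>c\<close>. This is the source of the term
  \<open>n R_(n-1)\<close> in the structure relation.\<close>

lemma coeff_shift_poly_top:
  assumes "degree p \<le> Suc k"
  shows "coeff (shift_poly c p) k = coeff p k + real (Suc k) * c * coeff p (Suc k)"
  using assms
proof (induction p arbitrary: k rule: pCons_induct)
  case 0
  then show ?case by (simp add: shift_poly_def)
next
  case (pCons r p)
  have shift: "shift_poly c (pCons r p) = [:r:] + smult c (shift_poly c p) + pCons 0 (shift_poly c p)"
    by (simp add: shift_poly_def pcompose_pCons)
  have deg: "degree p \<le> k"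
    using pCons.prems by (cases "p = 0") auto
  have top: "coeff (shift_poly c p) k = coeff p k"
  proof (cases "degree p = k")
    case True
    then show ?thesis using lead_coeff_shift_poly [of c p] by simp
  next
    case False
    then show ?thesis using deg by (simp add: coeff_eq_0)
  qed
  show ?case
  proof (cases k)
    case 0
    then show ?thesis using top by (simp add: shift)
  next
    case (Suc j)
    then have "coeff (shift_poly c p) j = coeff p j + real (Suc j) * c * coeff p (Suc j)"
      using pCons.IH deg by simp
    then show ?thesis using top Suc by (simp add: shift algebra_simps)
  qed
qed

section \<open>Monic orthogonal polynomials for an abstract positive functional\<close>

locale orthogonal_polynomials =
  fixes L :: "real poly \<Rightarrow> real" and R :: "nat \<Rightarrow> real poly" and A b :: "nat \<Rightarrow> real"
  assumes L_add: "L (p + q) = L p + L q"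
    and L_smult: "L (smult c p) = c * L p"
    and L_pos: "p \<noteq> 0 \<Longrightarrow> L (p * p) > 0"
    and degree_R: "degree (R n) = n"
    and lead_coeff_R: "lead_coeff (R n) = 1"
    and L_orthogonal: "m \<noteq> n \<Longrightarrow> L (R n * R m) = 0"
    and recurrence: "three_term_recurrence R A b"
begin

declare mult_pCons_left [simp del] mult_pCons_right [simp del]

definition h :: "nat \<Rightarrow> real" where "h n = L (R n * R n)"

lemma h_pos: "h n > 0"
  unfolding h_def using lead_coeff_R [of n] by (intro L_pos) auto

lemma coeff_R: "coeff (R n) n = 1"
  using lead_coeff_R [of n] by (simp add: degree_R)

lemma L_0: "L 0 = 0"
  using L_smult [of 0 0] by simp

lemma L_diff: "L (p - q) = L p - L q"
  using L_add [of "p - q" q] by simp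

lemma A_0: "A 0 = 0"
  using recurrence by (simp add: three_term_recurrence_def)

text \<open>The conditional of the recurrence disappears because \<open>A 0 = 0\<close>: at
  \<open>n = 0\<close> the truncated index gives \<open>R 0\<close>, but multiplied by zero.\<close>

lemma mult_x_R: "[:0, 1:] * R n = R (n + 1) + smult (b n) (R n) + smult (A n) (R (n - 1))"
  using recurrence A_0 by (auto simp: three_term_recurrence_def)

text \<open>Subtracting \<open>lead_coeff q\<close> times \<open>R ?d\<close> lowers the degree, so
  by strong induction only the component of \<open>q\<close> along \<open>R n\<close>
  survives.\<close>

lemma L_mult_R:
  assumes "degree q \<le> n"
  shows "L (q * R n) = coeff q n * h n"
  using assms
proof (induction "degree q" arbitrary: q rule: less_induct)
  case less
  let ?d = "degree q"
  let ?r = "q - smult (lead_coeff q) (R ?d)"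
  have split: "L (q * R n) = L (?r * R n) + lead_coeff q * L (R ?d * R n)"
    by (simp add: left_diff_distrib L_diff L_smult)
  have r: "?r = 0 \<or> degree ?r < ?d"
  \<comment> \<open>A constant \<open>q\<close> needs its own case: its remainder is zero, whose
    degree 0 is not below \<open>?d\<close>.\<close>
  proof (cases "?d = 0")
    case True
    then obtain c where "q = [:c:]" by (metis degree_eq_zeroE)
    moreover obtain e where "R 0 = [:e:]" by (metis degree_R degree_eq_zeroE)
    moreover have "coeff (R 0) 0 = 1" by (rule coeff_R)
    ultimately show ?thesis by simp
  next
    case False
    have "coeff ?r ?d = 0" by (simp add: coeff_R)
    moreover have "degree ?r \<le> ?d" by (intro degree_diff_le) (auto simp: degree_R)
    ultimately show ?thesis
      by (metis False degree_0 le_neq_implies_less leading_coeff_0_iff)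
  qed
  then have "coeff ?r n = 0"
    using less.prems by (metis coeff_0 coeff_eq_0 order_less_le_trans)
  moreover have "L (?r * R n) = coeff ?r n * h n"
  proof (cases "?r = 0")
    case True
    then show ?thesis by (simp only: mult_zero_left L_0 coeff_0)
  next
    case False
    then show ?thesis using r less.hyps [of ?r] less.prems by (meson less_le_trans less_imp_le)
  qed
  ultimately have "L (q * R n) = lead_coeff q * L (R ?d * R n)"
    using split by simp
  also have "\<dots> = coeff q n * h n"
  proof (cases "?d = n")
    case True
    then show ?thesis by (simp add: h_def)
  next
    case False
    then show ?thesis using less.prems by (simp add: L_orthogonal coeff_eq_0)
  qed
  finally show ?case .
qed

text \<open>By \<open>L_mult_R\<close>, pairing \<open>q\<close> with the \<open>R\<close> of its
  own degree detects its leading coefficient. Expansions in the \<open>R n\<close> can thus be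
  verified by comparing pairings.\<close>

lemma poly_eq_0_by_orthogonality:
  assumes "\<And>j. j \<le> degree q \<Longrightarrow> L (q * R j) = 0"
  shows "q = 0"
  using L_mult_R [of q "degree q"] assms [of "degree q"] h_pos [of "degree q"] by simp

lemma L_R_R: "L (R m * R n) = (if m = n then h n else 0)"
  by (auto simp: h_def L_orthogonal)

lemma L_mult_x_R: "L (q * ([:0, 1:] * R n)) = L (q * R (n + 1)) + b n * L (q * R n) + A n * L (q * R (n - 1))"
  unfolding mult_x_R by (simp only: distrib_left mult_smult_right L_add L_smult)

text \<open>The number \<open>L (x R_n R_(n+1))\<close> is computed by applying the recurrence to
  either factor.\<close>

lemma h_Suc: "h (Suc n) = A (Suc n) * h n"
proof -
  have "L (R n * ([:0, 1:] * R (Suc n))) = A (Suc n) * h n"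
    by (subst L_mult_x_R) (simp add: L_R_R)
  moreover have "L (R (Suc n) * ([:0, 1:] * R n)) = h (Suc n)"
    by (subst L_mult_x_R) (auto simp: L_R_R)
  ultimately show ?thesis by (simp add: mult_ac)
qed

lemma A_Suc_pos: "A (Suc n) > 0"
  using h_pos [of n] h_pos [of "Suc n"] by (simp add: h_Suc zero_less_mult_iff)

end

section \<open>Structure relation and recurrence coefficients from the Pearson equation\<close>

locale pearson_functional = orthogonal_polynomials +
  fixes a \<beta> :: real
  assumes a_pos: "a > 0"
    and pearson: "L ([:0, \<beta> - 1, 1:] * p) = a * L (shift_poly 1 p)"
begin

declare mult_pCons_left [simp del] mult_pCons_right [simp del]

abbreviation \<sigma> :: "real poly" where "\<sigma> \<equiv> [:0, \<beta> - 1, 1:]"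

lemma \<sigma>_eq: "\<sigma> = [:0, 1:] * [:0, 1:] + smult (\<beta> - 1) [:0, 1:]"
  by (simp add: mult_pCons_left)

text \<open>The Pearson equation moves the shift to the other factor: the translations by
  \<open>- 1\<close> and \<open>1\<close> cancel on \<open>q\<close>.\<close>

lemma L_\<sigma>_R_shift: "L (\<sigma> * (p * shift_poly (- 1) q)) = a * L (shift_poly 1 p * q)"
  by (simp add: pearson shift_poly_mult shift_poly_shift_poly)

text \<open>The polynomial \<sigma> is monic of degree 2 and shifting preserves leading
  coefficients, so the product paired with \<open>R n\<close> has degree at most \<open>n\<close>,
  and its coefficient at \<open>n\<close> is that of \<open>q\<close> at
  \<open>n - 2\<close>.\<close>

lemma L_\<sigma>_shift_top:
  assumes "degree q + 2 \<le> n"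
  shows "L (\<sigma> * (R n * shift_poly (- 1) q)) = coeff q (n - 2) * h n"
proof -
  let ?p = "\<sigma> * shift_poly (- 1) q"
  have deg: "degree ?p \<le> 2 + degree q"
    using degree_mult_le [of \<sigma> "shift_poly (- 1) q"] by simp
  have "L (\<sigma> * (R n * shift_poly (- 1) q)) = L (?p * R n)"
    by (simp only: mult_ac)
  also have "\<dots> = coeff ?p n * h n"
    using deg assms by (intro L_mult_R) simp
  also have "coeff ?p n = coeff q (n - 2)"
  proof (cases "degree q + 2 = n")
    case True
    have "coeff ?p (degree \<sigma> + degree (shift_poly (- 1) q))
        = lead_coeff \<sigma> * lead_coeff (shift_poly (- 1) q)"
      by (rule coeff_mult_degree_sum)
    moreover have "coeff (shift_poly (- 1) q) (degree q) = lead_coeff q"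
      using lead_coeff_shift_poly [of "- 1" q] by simp
    ultimately show ?thesis using True by (auto simp: add.commute)
  next
    case False
    then have "degree ?p < n" "degree q < n - 2" using deg assms by simp_all
    then show ?thesis by (simp only: coeff_eq_0)
  qed
  finally show ?thesis .
qed

lemma L_shift_R_same: "L (shift_poly 1 (R n) * R n) = h n"
proof -
  have "coeff (shift_poly 1 (R n)) n = 1"
    using lead_coeff_shift_poly [of 1 "R n"] by (simp add: degree_R coeff_R)
  then show ?thesis by (simp add: L_mult_R degree_R)
qed

text \<open>The difference \<open>R_(n+1)(x + 1) - R_(n+1)(x)\<close> has degree at most
  \<open>n\<close> and coefficient \<open>n + 1\<close> there, while \<open>R_(n+1)\<close> itself
  is orthogonal to \<open>R_n\<close>.\<close>

lemma L_shift_R_1: "L (shift_poly 1 (R (Suc n)) * R n) = real (Suc n) * h n"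
proof -
  let ?D = "shift_poly 1 (R (Suc n)) - R (Suc n)"
  have "coeff ?D (Suc n) = 0"
    using lead_coeff_shift_poly [of 1 "R (Suc n)"] by (simp add: degree_R coeff_R)
  moreover have "degree ?D \<le> Suc n"
    by (intro degree_diff_le) (simp_all add: degree_R)
  ultimately have "degree ?D \<le> n"
    by (metis degree_0 le_SucE leading_coeff_0_iff zero_le)
  then have "L (?D * R n) = coeff ?D n * h n"
    by (rule L_mult_R)
  moreover have "coeff ?D n = real (Suc n)"
    by (simp add: coeff_shift_poly_top degree_R coeff_R)
  ultimately show ?thesis
    by (simp add: left_diff_distrib L_diff L_R_R del: coeff_diff)
qed

lemma L_shift_R_2: "a * L (shift_poly 1 (R (Suc (Suc n))) * R n) = h (Suc (Suc n))"
  using L_\<sigma>_shift_top [of "R n" "Suc (Suc n)"]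
  by (simp add: L_\<sigma>_R_shift degree_R coeff_R)

lemma L_shift_R_less:
  assumes "j + 2 < n"
  shows "L (shift_poly 1 (R n) * R j) = 0"
  using L_\<sigma>_shift_top [of "R j" n] assms a_pos
  by (simp add: L_\<sigma>_R_shift degree_R coeff_eq_0)

text \<open>Truncated subtraction in the indices is harmless in \<open>g\<close> and \<open>shift_R\<close>: as \<open>A 0 = 0\<close>,
  every term with a negative index has coefficient \<open>0\<close>.\<close>
definition g :: "nat \<Rightarrow> real" where "g n = A n * A (n - 1) / a"

lemma shift_R:
  "shift_poly 1 (R n) = R n + smult (real n) (R (n - 1)) + smult (g n) (R (n - 2))"
    (is "?S = ?T")
proof -
  have "?S - ?T = 0"
  proof (rule poly_eq_0_by_orthogonality)
    fix j
    assume "j \<le> degree (?S - ?T)"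
    also have "degree (?S - ?T) \<le> n"
      by (intro degree_diff_le degree_add_le degree_smult_le [THEN order_trans])
        (simp_all add: degree_R)
    finally have "j \<le> n" .
    have "L (?T * R j) = (if j = n then h n else 0) + real n * (if j = n - 1 then h j else 0)
        + g n * (if j = n - 2 then h j else 0)"
      by (auto simp: distrib_right L_add L_smult L_R_R)
    moreover consider "j = n" | "n = Suc j" | "n = Suc (Suc j)" | "j + 2 < n"
      using \<open>j \<le> n\<close> by linarith
    then have "L (?S * R j) = (if j = n then h n else 0) + real n * (if j = n - 1 then h j else 0)
        + g n * (if j = n - 2 then h j else 0)"
    proof cases
      case 1
      then show ?thesis
        using A_0 by (cases "n = 0"; cases "n = 1") (auto simp: L_shift_R_same g_def)
    next
      case 2
      then show ?thesis
        using A_0 by (cases "j = 0") (auto simp: L_shift_R_1 g_def)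
    next
      case 3
      then have "a * L (?S * R j) = A n * A (n - 1) * h j"
        using L_shift_R_2 [of j] by (simp add: h_Suc)
      then show ?thesis using 3 a_pos by (simp add: g_def field_simps)
    next
      case 4
      then show ?thesis by (auto simp: L_shift_R_less)
    qed
    ultimately show "L ((?S - ?T) * R j) = 0"
      by (simp add: left_diff_distrib L_diff)
  qed
  then show ?thesis by simp
qed

text \<open>This is the structure relation read at \<open>x - 1\<close>. The lower terms are
  deliberately left shifted, so that \<open>L_\<sigma>_shift_top\<close> or the Pearson equation
  evaluates them.\<close>

lemma shift_back_R:
  "shift_poly (- 1) (R n) = R n - smult (real n) (shift_poly (- 1) (R (n - 1)))
     - smult (g n) (shift_poly (- 1) (R (n - 2)))"
  using arg_cong [OF shift_R [of n], of "shift_poly (- 1)"]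
  by (simp add: shift_poly_add shift_poly_smult shift_poly_shift_poly algebra_simps)

lemma L_\<sigma>_shift_back_R:
  "L (\<sigma> * (p * shift_poly (- 1) (R n))) = L (\<sigma> * (p * R n))
     - real n * L (\<sigma> * (p * shift_poly (- 1) (R (n - 1))))
     - g n * L (\<sigma> * (p * shift_poly (- 1) (R (n - 2))))"
  by (subst shift_back_R) (simp only: right_diff_distrib mult_smult_right L_diff L_smult)

text \<open>Splitting \<open>x^2\<close> as one factor \<open>x\<close> for each polynomial lets the
  three-term recurrence act on both sides.\<close>

lemma L_\<sigma>_mult:
  "L (\<sigma> * (p * q)) = L (([:0, 1:] * p) * ([:0, 1:] * q)) + (\<beta> - 1) * L (p * ([:0, 1:] * q))"
proof -
  have "\<sigma> * (p * q) = ([:0, 1:] * p) * ([:0, 1:] * q) + smult (\<beta> - 1) (p * ([:0, 1:] * q))"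
    unfolding \<sigma>_eq by (simp only: ring_distribs mult_smult_left mult_smult_right mult_ac)
  then show ?thesis by (simp only: L_add L_smult)
qed

lemma L_xR_xR:
  "L (([:0, 1:] * p) * ([:0, 1:] * R n)) = L (R (n + 1) * ([:0, 1:] * p))
    + b n * L (R n * ([:0, 1:] * p)) + A n * L (R (n - 1) * ([:0, 1:] * p))"
  by (subst L_mult_x_R) (simp only: mult_ac)

lemma L_\<sigma>_R_R: "L (\<sigma> * (R n * R n)) = (A (n + 1) + A n + (b n)\<^sup>2 + (\<beta> - 1) * b n) * h n"
proof (cases n)
  case 0
  then show ?thesis
    unfolding L_\<sigma>_mult L_xR_xR unfolding L_mult_x_R
    using A_0 by (simp add: L_R_R h_Suc power2_eq_square algebra_simps)
next
  case (Suc m)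
  then show ?thesis
    unfolding L_\<sigma>_mult L_xR_xR unfolding L_mult_x_R
    by (simp add: L_R_R h_Suc power2_eq_square algebra_simps)
qed

lemma L_\<sigma>_R_R_1: "L (\<sigma> * (R (Suc n) * R n)) = (b (Suc n) + b n + \<beta> - 1) * h (Suc n)"
proof (cases n)
  case 0
  then show ?thesis
    unfolding L_\<sigma>_mult L_xR_xR unfolding L_mult_x_R
    using A_0 by (simp add: L_R_R h_Suc algebra_simps)
next
  case (Suc m)
  then show ?thesis
    unfolding L_\<sigma>_mult L_xR_xR unfolding L_mult_x_R
    by (simp add: L_R_R h_Suc algebra_simps)
qed

lemma b_sum: "(b (Suc n) + b n + \<beta> - real (Suc n)) * A (Suc n) = a * real (Suc n)"
proof -
  \<comment> \<open>The factor \<open>real n\<close> must stay: at \<open>n = 0\<close> the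
    truncated index \<open>n - 1\<close> breaks the degree bound, and both sides vanish only through
    this factor.\<close>
  have "real n * L (\<sigma> * (R (Suc n) * shift_poly (- 1) (R (n - 1)))) = real n * h (Suc n)"
    using L_\<sigma>_shift_top [of "R (n - 1)" "Suc n"] by (cases n) (simp_all add: degree_R coeff_R)
  moreover have "g n * L (\<sigma> * (R (Suc n) * shift_poly (- 1) (R (n - 2)))) = 0"
  proof (cases "n < 2")
    case True
    then have "g n = 0" using A_0 by (auto simp: g_def less_2_cases_iff)
    then show ?thesis by simp
  next
    case False
    then show ?thesis
      using L_\<sigma>_shift_top [of "R (n - 2)" "Suc n"] by (simp add: degree_R coeff_eq_0)
  qed
  ultimately have "a * (real (Suc n) * h n)
      = (b (Suc n) + b n + \<beta> - 1) * h (Suc n) - real n * h (Suc n)"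
    using L_\<sigma>_shift_back_R [of "R (Suc n)" n]
    by (simp only: L_\<sigma>_R_shift L_shift_R_1 L_\<sigma>_R_R_1)
  then have "h n * ((b (Suc n) + b n + \<beta> - real (Suc n)) * A (Suc n)) = h n * (a * real (Suc n))"
    by (simp add: h_Suc algebra_simps)
  then show ?thesis using h_pos [of n] by simp
qed

text \<open>Both evaluations of \<open>L (\<sigma> R_n(x) R_n(x - 1))\<close> are compared, one by
  Pearson and one by \<open>shift_back_R\<close>. At \<open>n = 0\<close> the quotient by
  \<open>A 0 = 0\<close> has numerator zero and contributes nothing.\<close>

lemma diagonal_identity:
  "a = A (n + 1) + A n + (b n)\<^sup>2 + (\<beta> - 1) * b n - a * (real n)\<^sup>2 / A n - g n"
proof -
  have "real n * L (\<sigma> * (R n * shift_poly (- 1) (R (n - 1)))) = a * (real n)\<^sup>2 / A n * h n"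
  proof (cases n)
    case 0
    then show ?thesis by simp
  next
    case (Suc m)
    then show ?thesis
      using A_Suc_pos [of m]
      by (simp add: L_\<sigma>_R_shift L_shift_R_1 h_Suc power2_eq_square del: of_nat_Suc)
  qed
  moreover have "g n * L (\<sigma> * (R n * shift_poly (- 1) (R (n - 2)))) = g n * h n"
  proof (cases "n < 2")
    case True
    then have "g n = 0" using A_0 by (auto simp: g_def less_2_cases_iff)
    then show ?thesis by simp
  next
    case False
    then show ?thesis
      using L_\<sigma>_shift_top [of "R (n - 2)" n] by (simp add: degree_R coeff_R)
  qed
  ultimately have "a * h n = L (\<sigma> * (R n * R n)) - a * (real n)\<^sup>2 / A n * h n - g n * h n"
    using L_\<sigma>_shift_back_R [of "R n" n]
    by (simp only: L_\<sigma>_R_shift L_shift_R_same)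
  then have "h n * a = h n * (A (n + 1) + A n + (b n)\<^sup>2 + (\<beta> - 1) * b n - a * (real n)\<^sup>2 / A n - g n)"
    unfolding L_\<sigma>_R_R by (simp add: algebra_simps)
  then show ?thesis using h_pos [of n] by simp
qed

text \<open>Compatibility of the shift with the recurrence: the polynomial
  \<open>(x + 1) R\<^sub>n(x + 1)\<close> is paired with \<open>R\<^sub>n\<^sub>-\<^sub>1\<close> in two ways.\<close>
lemma g_diff: "g (n + 1) - g n = real n * (b (n - 1) - b n + 1)"
proof (cases n)
  case 0
  then show ?thesis using A_0 by (simp add: g_def)
next
  case (Suc m)
  let ?U = "shift_poly 1"
  have x: "?U [:0, 1:] = [:0, 1:] + 1"
    by (simp add: shift_poly_def pcompose_pCons one_pCons mult_pCons_right)
  have "?U ([:0, 1:] * R n) = ([:0, 1:] + 1) * ?U (R n)"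
    by (simp only: shift_poly_mult x)
  then have eq: "([:0, 1:] + 1) * ?U (R n) = ?U (R (n + 1)) + smult (b n) (?U (R n)) + smult (A n) (?U (R m))"
    by (simp only: mult_x_R shift_poly_add shift_poly_smult Suc diff_Suc_1)
  have "L (?U (R n) * ([:0, 1:] * R m)) + L (?U (R n) * R m)
      = L (?U (R (n + 1)) * R m) + b n * L (?U (R n) * R m) + A n * L (?U (R m) * R m)"
    using arg_cong [OF eq, of "\<lambda>p. L (p * R m)"]
    by (simp add: ring_distribs L_add L_smult mult_ac)
  moreover have "A m * L (?U (R n) * R (m - 1)) = g n * h m"
  proof (cases m)
    case 0
    then show ?thesis using Suc A_0 by (simp add: g_def)
  next
    case (Suc l)
    then show ?thesis
      using L_shift_R_2 [of l] a_pos \<open>n = Suc m\<close> by (simp add: g_def h_Suc field_simps)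
  qed
  then have "L (?U (R n) * ([:0, 1:] * R m)) = h n + b m * (real n * h m) + g n * h m"
    using Suc by (simp add: L_mult_x_R L_shift_R_1 L_shift_R_same)
  moreover have "L (?U (R (n + 1)) * R m) = g (n + 1) * h m"
    using L_shift_R_2 [of m] a_pos Suc by (simp add: h_Suc g_def field_simps)
  ultimately have "h m * (g (n + 1) - g n) = h m * (real n * (b m - b n + 1))"
    using Suc L_shift_R_1 [of m] L_shift_R_same [of m]
    by (simp add: h_Suc algebra_simps del: of_nat_Suc)
  then show ?thesis using h_pos [of m] Suc by simp
qed

text \<open>The product \<open>A_(n+1) A_n\<close> equals \<open>a g_(n+1)\<close>, which
  \<open>g_diff\<close> reduces to \<open>g_n\<close>; \<open>a^2\<close> is replaced through the
  diagonal identity. Then \<open>g_n\<close> cancels, and expressing \<open>K\<close> by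
  \<open>b_sum\<close> also cancels \<open>b_(n-1)\<close>.\<close>

lemma discrete_painleve:
  "(A (n + 1) - a) * (A n - a) = a * (b n - real n) * (b n - real n + \<beta> - 1)"
proof -
  define K where "K = a * (real n)\<^sup>2 / A n"
  have "a * K = a * (real n * (b n + b (n - 1) + \<beta> - real n))"
  proof (cases n)
    case (Suc m)
    then show ?thesis
      using b_sum [of m] A_Suc_pos [of m] by (simp add: K_def power2_eq_square add_ac divide_eq_eq mult_ac del: of_nat_Suc)
  qed (simp add: K_def)
  moreover have "a * g (n + 1) = A (n + 1) * A n"
    using a_pos by (simp add: g_def)
  moreover have "a * (A (n + 1) + A n + (b n)\<^sup>2 + (\<beta> - 1) * b n - K - g n) = a * a"
    using diagonal_identity [of n] by (simp add: K_def)
  moreover have "a * (g (n + 1) - g n) = a * (real n * (b (n - 1) - b n + 1))"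
    using g_diff [of n] by simp
  ultimately show ?thesis
    by (simp add: algebra_simps power2_eq_square)
qed

end

section \<open>Weights and convergent sums on a single lattice\<close>

text \<open>One family covers both lattices: up to constant factors, parameter \<beta> gives
  \<open>w_k\<close> and parameter \<open>2 - \<beta>\<close> gives \<open>v_k\<close>. Using
  \<open>rGamma\<close> keeps the formula valid at nonpositive parameters, which the series of
  \<open>I_(-\<beta>)\<close> can require.\<close>

definition lattice_weight :: "real \<Rightarrow> real \<Rightarrow> nat \<Rightarrow> real" where
  "lattice_weight a \<delta> k = a ^ k / fact k * rGamma (real k + \<delta>)"

definition lattice_sum :: "real \<Rightarrow> real \<Rightarrow> real \<Rightarrow> real poly \<Rightarrow> real" where
  "lattice_sum a \<delta> s p = (\<Sum>k. poly p (real k + s) * lattice_weight a \<delta> k)"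

lemma lattice_weight_pos: "a > 0 \<Longrightarrow> \<delta> > 0 \<Longrightarrow> lattice_weight a \<delta> k > 0"
  by (simp add: lattice_weight_def rGamma_inverse_Gamma Gamma_real_pos)

lemma lattice_weight_Suc:
  "(real k + 1) * (real k + \<delta>) * lattice_weight a \<delta> (Suc k) = a * lattice_weight a \<delta> k"
proof -
  have "(real k + \<delta>) * rGamma (real (Suc k) + \<delta>) = rGamma (real k + \<delta>)"
    using rGamma_plus1 [of "real k + \<delta>"] by (simp add: add_ac)
  moreover have "(real k + 1) * (a ^ Suc k / fact (Suc k)) = a * (a ^ k / fact k)"
    by (simp add: divide_simps)
  ultimately show ?thesis
    unfolding lattice_weight_def by (metis (no_types, opaque_lifting) mult.assoc mult.left_commute)
qed

lemma lattice_weight_Suc_mult: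
  "(real k + 1) * lattice_weight a \<delta> (Suc k) = a * lattice_weight a (\<delta> + 1) k"
  by (simp add: lattice_weight_def divide_simps) (simp add: algebra_simps)

lemma lattice_weight_mult:
  "(real k + \<delta>) * lattice_weight a (\<delta> + 1) k = lattice_weight a \<delta> k"
  using rGamma_plus1 [of "real k + \<delta>"] by (simp add: lattice_weight_def add_ac mult_ac)

lemma summable_lattice_weight:
  assumes "a > 0" "\<delta> > 0"
  shows "summable (lattice_weight a \<delta>)"
proof (rule summable_ratio_test)
  show "(1 / 2 :: real) < 1" by simp
next
  \<comment> \<open>The ratio of consecutive weights is \<open>a / ((k + 1) (k + \<delta>))\<close>,
    at most \<open>a / ((k + 1) \<delta>)\<close>; this is at most \<open>1 / 2\<close> beyond the
    chosen index.\<close>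
  fix k :: nat
  assume k: "nat \<lceil>2 * a / \<delta>\<rceil> \<le> k"
  have "2 * a / \<delta> \<le> real k + 1" using k by linarith
  then have "2 * a \<le> (real k + 1) * \<delta>"
    using assms by (simp add: field_simps)
  also have "\<dots> \<le> (real k + 1) * (real k + \<delta>)"
    by (intro mult_left_mono) auto
  finally have "2 * a * lattice_weight a \<delta> (Suc k) \<le> a * lattice_weight a \<delta> k"
    unfolding lattice_weight_Suc [symmetric]
    using lattice_weight_pos [OF assms, of "Suc k"] by (intro mult_right_mono) auto
  then show "norm (lattice_weight a \<delta> (Suc k)) \<le> 1 / 2 * norm (lattice_weight a \<delta> k)"
    using assms lattice_weight_pos [OF assms, of "Suc k"] lattice_weight_pos [OF assms, of k]
    by simp
qed

text \<open>An exponential majorant is convenient because \<open>exp (m k)\<close> can be absorbed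
  into the factor \<open>a^k\<close> of the weight; polynomial moments then converge by comparison
  with the weight of parameter \<open>exp m * a\<close>.\<close>

lemma poly_le_exp:
  fixes p :: "real poly"
  shows "\<exists>C m. C \<ge> 0 \<and> m \<ge> 0 \<and> (\<forall>x. \<bar>poly p x\<bar> \<le> C * exp (m * \<bar>x\<bar>))"
proof (induction p rule: pCons_induct)
  case 0
  show ?case by (intro exI [of _ 0]) simp
next
  case (pCons c p)
  then obtain C m where Cm: "C \<ge> 0" "m \<ge> 0" "\<And>x. \<bar>poly p x\<bar> \<le> C * exp (m * \<bar>x\<bar>)"
    by blast
  have "\<bar>poly (pCons c p) x\<bar> \<le> (\<bar>c\<bar> + C) * exp ((m + 1) * \<bar>x\<bar>)" for x
  proof -
    have "\<bar>x\<bar> \<le> exp \<bar>x\<bar>"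
      using exp_ge_add_one_self [of "\<bar>x\<bar>"] by linarith
    then have "\<bar>x\<bar> * \<bar>poly p x\<bar> \<le> exp \<bar>x\<bar> * (C * exp (m * \<bar>x\<bar>))"
      using Cm by (intro mult_mono) auto
    also have "\<dots> = C * exp ((m + 1) * \<bar>x\<bar>)"
      by (simp add: exp_add distrib_right)
    finally have "\<bar>x * poly p x\<bar> \<le> C * exp ((m + 1) * \<bar>x\<bar>)"
      by (simp add: abs_mult)
    moreover have "\<bar>c\<bar> * 1 \<le> \<bar>c\<bar> * exp ((m + 1) * \<bar>x\<bar>)"
      using Cm by (intro mult_left_mono) auto
    ultimately show ?thesis
      using abs_triangle_ineq [of c "x * poly p x"] by (simp add: distrib_right)
  qed
  then show ?case using Cm by (intro exI [of _ "\<bar>c\<bar> + C"] exI [of _ "m + 1"]) auto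
qed

lemma summable_lattice_sum:
  assumes "a > 0" "\<delta> > 0"
  shows "summable (\<lambda>k. poly p (real k + s) * lattice_weight a \<delta> k)"
proof -
  obtain C m where Cm: "C \<ge> 0" "m \<ge> 0" "\<And>x. \<bar>poly p x\<bar> \<le> C * exp (m * \<bar>x\<bar>)"
    using poly_le_exp by blast
  show ?thesis
  proof (rule summable_comparison_test')
    show "summable (\<lambda>k. C * exp (m * \<bar>s\<bar>) * lattice_weight (exp m * a) \<delta> k)"
      using assms by (intro summable_mult summable_lattice_weight) auto
  next
    fix k :: nat
    have "\<bar>poly p (real k + s)\<bar> \<le> C * exp (m * \<bar>real k + s\<bar>)" by (rule Cm)
    also have "\<dots> \<le> C * exp (m * (real k + \<bar>s\<bar>))"
      using Cm by (auto intro!: mult_left_mono)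
    also have "\<dots> = C * exp (m * \<bar>s\<bar>) * exp m ^ k"
      by (simp add: distrib_left exp_add mult_ac flip: exp_of_nat_mult)
    finally have "\<bar>poly p (real k + s)\<bar> * lattice_weight a \<delta> k
        \<le> C * exp (m * \<bar>s\<bar>) * exp m ^ k * lattice_weight a \<delta> k"
      using lattice_weight_pos [OF assms, of k] by (intro mult_right_mono) auto
    also have "\<dots> = C * exp (m * \<bar>s\<bar>) * lattice_weight (exp m * a) \<delta> k"
      by (simp add: lattice_weight_def power_mult_distrib)
    finally show "norm (poly p (real k + s) * lattice_weight a \<delta> k)
        \<le> C * exp (m * \<bar>s\<bar>) * lattice_weight (exp m * a) \<delta> k"
      using lattice_weight_pos [OF assms, of k] by (simp add: abs_mult)
  qed
qed

lemma lattice_sum_add: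
  assumes "a > 0" "\<delta> > 0"
  shows "lattice_sum a \<delta> s (p + q) = lattice_sum a \<delta> s p + lattice_sum a \<delta> s q"
  unfolding lattice_sum_def
  using suminf_add [OF summable_lattice_sum [OF assms, of p s] summable_lattice_sum [OF assms, of q s]]
  by (simp add: distrib_right)

lemma lattice_sum_smult:
  assumes "a > 0" "\<delta> > 0"
  shows "lattice_sum a \<delta> s (smult c p) = c * lattice_sum a \<delta> s p"
  unfolding lattice_sum_def
  using suminf_mult [OF summable_lattice_sum [OF assms, of p s], of c]
  by (simp add: mult_ac)

text \<open>A nonzero polynomial has finitely many roots, so it cannot vanish on the whole infinite
  lattice.\<close>

lemma lattice_sum_square_pos:
  assumes "a > 0" "\<delta> > 0" "p \<noteq> 0"
  shows "lattice_sum a \<delta> s (p * p) > 0"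
proof -
  have "infinite (range (\<lambda>k. real k + s))"
    by (intro range_inj_infinite injI) simp
  then obtain k where k: "poly p (real k + s) \<noteq> 0"
    using poly_roots_finite [OF \<open>p \<noteq> 0\<close>] by (metis (mono_tags, lifting) finite_subset
      image_subset_iff mem_Collect_eq)
  show ?thesis
    unfolding lattice_sum_def
  proof (rule suminf_pos2)
    show "summable (\<lambda>k. poly (p * p) (real k + s) * lattice_weight a \<delta> k)"
      using assms by (intro summable_lattice_sum)
    show "0 \<le> poly (p * p) (real i + s) * lattice_weight a \<delta> i" for i
      using lattice_weight_pos [of a \<delta> i] assms by simp
    show "0 < poly (p * p) (real k + s) * lattice_weight a \<delta> k"
      using lattice_weight_pos [of a \<delta> k] assms k by (auto simp: zero_less_mult_iff not_less linorder_neq_iff)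
  qed
qed

text \<open>Summation by shifting the index: \<open>s\<close> is chosen such that the quadratic factor
  vanishes at the starting point of the lattice.\<close>
lemma lattice_sum_pearson:
  assumes "a > 0" "\<delta> > 0" and s: "s = 0 \<and> \<delta> = \<beta> \<or> s = 1 - \<beta> \<and> \<delta> = 2 - \<beta>"
  shows "lattice_sum a \<delta> s ([:0, \<beta> - 1, 1:] * p) = a * lattice_sum a \<delta> s (shift_poly 1 p)"
proof -
  let ?\<sigma> = "[:0, \<beta> - 1, 1:]"
  have \<sigma>: "poly ?\<sigma> (real k + s) = real k * (real k + \<delta> - 1)" for k
  proof -
    have "s * (s + \<beta> - 1) = 0" "2 * s + \<beta> = \<delta>" using s by auto
    moreover have "poly ?\<sigma> (real k + s) = real k * (real k + (2 * s + \<beta>) - 1) + s * (s + \<beta> - 1)"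
      by (simp add: algebra_simps)
    ultimately show ?thesis by simp
  qed
  have "lattice_sum a \<delta> s (?\<sigma> * p)
      = (\<Sum>k. poly (?\<sigma> * p) (real (Suc k) + s) * lattice_weight a \<delta> (Suc k))"
    using suminf_split_head [OF summable_lattice_sum [OF assms(1,2), of "?\<sigma> * p" s]] \<sigma> [of 0]
    unfolding lattice_sum_def by (simp del: mult_pCons_left)
  also have "\<dots> = (\<Sum>k. a * (poly (shift_poly 1 p) (real k + s) * lattice_weight a \<delta> k))"
  proof (rule suminf_cong)
    fix k
    have "poly (?\<sigma> * p) (real (Suc k) + s) * lattice_weight a \<delta> (Suc k)
        = poly p (real (Suc k) + s) * ((real k + 1) * (real k + \<delta>) * lattice_weight a \<delta> (Suc k))"
      unfolding poly_mult \<sigma> by simp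
    then show "poly (?\<sigma> * p) (real (Suc k) + s) * lattice_weight a \<delta> (Suc k)
        = a * (poly (shift_poly 1 p) (real k + s) * lattice_weight a \<delta> k)"
      unfolding lattice_weight_Suc by (simp add: add_ac)
  qed
  also have "\<dots> = a * lattice_sum a \<delta> s (shift_poly 1 p)"
    unfolding lattice_sum_def by (intro suminf_mult summable_lattice_sum assms)
  finally show ?thesis .
qed

section \<open>The bi-lattice functional and its mean in Bessel functions\<close>

text \<open>Here the inner product becomes a functional of the product polynomial, as the abstract
  theory needs; \<open>Gamma \<beta>\<close> and \<open>a powr (1 - \<beta>)\<close> are the
  constants split off from the weights.\<close>

definition bilattice_functional :: "real \<Rightarrow> real \<Rightarrow> real \<Rightarrow> real \<Rightarrow> real poly \<Rightarrow> real" where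
  "bilattice_functional a \<beta> c d p = Gamma \<beta> *
     (c * lattice_sum a \<beta> 0 p + d * a powr (1 - \<beta>) * lattice_sum a (2 - \<beta>) (1 - \<beta>) p)"

lemma bilattice_inner_eq:
  assumes "a > 0" "0 < \<beta>" "\<beta> < 2"
  shows "bilattice_inner a \<beta> c d p q = bilattice_functional a \<beta> c d (p * q)"
proof -
  have w: "weight a \<beta> (real k) = Gamma \<beta> * lattice_weight a \<beta> k" for k
    using assms Gamma_fact [of k, where ?'a = real]
    by (simp add: weight_def lattice_weight_def rGamma_inverse_Gamma powr_realpow field_simps)
  have v: "weight a \<beta> (real k + 1 - \<beta>)
      = Gamma \<beta> * a powr (1 - \<beta>) * lattice_weight a (2 - \<beta>) k" for k
  proof -
    have "a powr (real k + 1 - \<beta>) = a ^ k * a powr (1 - \<beta>)"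
      using powr_add [of a "real k" "1 - \<beta>"] assms by (simp add: powr_realpow add_diff_eq)
    moreover have "real k + 1 - \<beta> + 1 = real k + (2 - \<beta>)" by simp
    ultimately show ?thesis
      using Gamma_fact [of k, where ?'a = real]
      by (simp add: weight_def lattice_weight_def rGamma_inverse_Gamma field_simps)
  qed
  have "(\<Sum>k. poly p (real k) * poly q (real k) * weight a \<beta> (real k))
      = (\<Sum>k. Gamma \<beta> * (poly (p * q) (real k + 0) * lattice_weight a \<beta> k))"
    by (simp add: w mult_ac)
  also have "\<dots> = Gamma \<beta> * lattice_sum a \<beta> 0 (p * q)"
    unfolding lattice_sum_def using assms by (intro suminf_mult summable_lattice_sum)
  finally have 1: "(\<Sum>k. poly p (real k) * poly q (real k) * weight a \<beta> (real k))
      = Gamma \<beta> * lattice_sum a \<beta> 0 (p * q)" .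
  have "(\<Sum>k. poly p (real k + 1 - \<beta>) * poly q (real k + 1 - \<beta>) * weight a \<beta> (real k + 1 - \<beta>))
      = (\<Sum>k. Gamma \<beta> * a powr (1 - \<beta>) *
          (poly (p * q) (real k + (1 - \<beta>)) * lattice_weight a (2 - \<beta>) k))"
    by (simp add: v mult_ac add_diff_eq)
  also have "\<dots> = Gamma \<beta> * a powr (1 - \<beta>) * lattice_sum a (2 - \<beta>) (1 - \<beta>) (p * q)"
    unfolding lattice_sum_def using assms by (intro suminf_mult summable_lattice_sum) auto
  finally show ?thesis
    unfolding bilattice_inner_def bilattice_functional_def 1 by (simp add: algebra_simps)
qed

text \<open>Summability is assumed in place of a positive parameter, since \<nu> = -\<beta> leads to
  \<open>1 - \<beta>\<close>, which may be nonpositive.\<close>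

lemma bessel_I_eq:
  assumes "a > 0" and "summable (lattice_weight a (\<nu> + 1))"
  shows "bessel_I \<nu> (2 * sqrt a) = a powr (\<nu> / 2) * suminf (lattice_weight a (\<nu> + 1))"
proof -
  have "(2 * sqrt a / 2) powr (2 * real k + \<nu>) = a powr (\<nu> / 2) * a ^ k" for k
  proof -
    have "(2 * sqrt a / 2) powr (2 * real k + \<nu>) = a powr (1 / 2 * (2 * real k + \<nu>))"
      using assms by (simp add: powr_powr flip: powr_half_sqrt)
    also have "1 / 2 * (2 * real k + \<nu>) = \<nu> / 2 + real k" by simp
    finally show ?thesis using assms by (simp only: powr_add powr_realpow)
  qed
  then have "bessel_I \<nu> (2 * sqrt a) = (\<Sum>k. a powr (\<nu> / 2) * lattice_weight a (\<nu> + 1) k)"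
    by (simp add: bessel_I_def lattice_weight_def add.assoc mult_ac)
  also have "\<dots> = a powr (\<nu> / 2) * suminf (lattice_weight a (\<nu> + 1))"
    using assms by (intro suminf_mult)
  finally show ?thesis .
qed

lemma lattice_sum_1: "lattice_sum a \<delta> s 1 = suminf (lattice_weight a \<delta>)"
  by (simp add: lattice_sum_def)

text \<open>The factor \<open>k\<close> cancels against the factorial; shifting the index then
  raises the Gamma parameter by one.\<close>

lemma lattice_sum_x_0:
  assumes "a > 0" "\<delta> > 0"
  shows "lattice_sum a \<delta> 0 [:0, 1:] = a * suminf (lattice_weight a (\<delta> + 1))"
proof -
  have "lattice_sum a \<delta> 0 [:0, 1:] = (\<Sum>k. (real k + 1) * lattice_weight a \<delta> (Suc k))"
    using suminf_split_head [OF summable_lattice_sum [OF assms, of "[:0, 1:]" 0]]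
    by (simp add: lattice_sum_def add_ac)
  also have "\<dots> = a * suminf (lattice_weight a (\<delta> + 1))"
    unfolding lattice_weight_Suc_mult using assms by (intro suminf_mult summable_lattice_weight) auto
  finally show ?thesis .
qed

lemma lattice_weight_mult_x:
  "(\<lambda>k. poly [:0, 1:] (real k + s) * lattice_weight a (s + 1) k) = lattice_weight a s"
  using lattice_weight_mult [of _ s a] by (simp add: fun_eq_iff)

text \<open>At \<open>x = k + s\<close> the factor \<open>x\<close> cancels one Gamma factor and
  lowers the parameter from \<open>s + 1\<close> to \<open>s\<close>. The same identity gives
  convergence for -1 < s \<le> 0, beyond the reach of
  \<open>summable_lattice_weight\<close>.\<close>

lemma
  assumes "a > 0" "s > - 1"
  shows lattice_sum_x: "lattice_sum a (s + 1) s [:0, 1:] = suminf (lattice_weight a s)"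
    and summable_lattice_weight_gt: "summable (lattice_weight a s)"
  using summable_lattice_sum [of a "s + 1" "[:0, 1:]" s] assms
  unfolding lattice_sum_def lattice_weight_mult_x by simp_all

lemma bilattice_mean:
  assumes "a > 0" "0 < \<beta>" "\<beta> < 2" "c > 0" "d > 0"
  shows "bilattice_functional a \<beta> c d [:0, 1:] / bilattice_functional a \<beta> c d 1 =
    sqrt a * ((bessel_I \<beta> (2 * sqrt a) + d / c * bessel_I (- \<beta>) (2 * sqrt a)) /
      (bessel_I (\<beta> - 1) (2 * sqrt a) + d / c * bessel_I (1 - \<beta>) (2 * sqrt a)))"
proof -
  \<comment> \<open>In \<open>u\<close> and \<open>v\<close> all powers of \<open>a\<close> become
    monomials: the four Bessel prefactors are \<open>v / u\<close>, \<open>u / v\<close>,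
    \<open>1 / u\<close> and \<open>u\<close>.\<close>
  define u where "u = a powr ((1 - \<beta>) / 2)"
  define v where "v = sqrt a"
  have pos: "u > 0" "v > 0" "Gamma \<beta> > 0"
    using assms by (simp_all add: u_def v_def Gamma_real_pos)
  have v2: "a = v * v" using assms by (simp add: v_def)
  have u2: "a powr (1 - \<beta>) = u * u"
    by (simp add: u_def flip: powr_add)
  have half: "a powr (1 / 2) = v"
    using assms by (simp add: v_def powr_half_sqrt)
  have p1: "a powr (\<beta> / 2) = v / u"
    unfolding half [symmetric] u_def by (simp add: field_simps flip: powr_diff)
  have p2: "a powr (- \<beta> / 2) = u / v"
    unfolding half [symmetric] u_def by (simp add: field_simps flip: powr_diff)
  have p3: "a powr ((\<beta> - 1) / 2) = 1 / u"
  proof -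
    have "(\<beta> - 1) / 2 = - ((1 - \<beta>) / 2)" by argo
    then show ?thesis by (simp only: u_def powr_minus_divide)
  qed
  let ?S = "\<lambda>\<delta>. suminf (lattice_weight a \<delta>)"
  have I1: "bessel_I \<beta> (2 * sqrt a) = v / u * ?S (\<beta> + 1)"
    using assms p1 by (simp add: bessel_I_eq summable_lattice_weight)
  have I2: "bessel_I (- \<beta>) (2 * sqrt a) = u / v * ?S (1 - \<beta>)"
    using assms p2 summable_lattice_weight_gt [of a "1 - \<beta>"] bessel_I_eq [of a "- \<beta>"] by simp
  have I3: "bessel_I (\<beta> - 1) (2 * sqrt a) = 1 / u * ?S \<beta>"
    using assms p3 summable_lattice_weight [of a \<beta>] bessel_I_eq [of a "\<beta> - 1"] by simp
  have I4: "bessel_I (1 - \<beta>) (2 * sqrt a) = u * ?S (2 - \<beta>)"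
    using assms summable_lattice_weight [of a "2 - \<beta>"] bessel_I_eq [of a "1 - \<beta>"]
    by (simp add: u_def)
  have L1: "bilattice_functional a \<beta> c d 1 = Gamma \<beta> * (c * ?S \<beta> + d * (u * u) * ?S (2 - \<beta>))"
    by (simp add: bilattice_functional_def lattice_sum_1 u2)
  have Lx: "bilattice_functional a \<beta> c d [:0, 1:]
      = Gamma \<beta> * (c * ((v * v) * ?S (\<beta> + 1)) + d * (u * u) * ?S (1 - \<beta>))"
    using assms lattice_sum_x_0 [of a \<beta>] lattice_sum_x [of a "1 - \<beta>"]
    by (simp add: bilattice_functional_def u2 flip: v2)
  have "bilattice_functional a \<beta> c d [:0, 1:] / bilattice_functional a \<beta> c d 1
      = (c * ((v * v) * ?S (\<beta> + 1)) + d * (u * u) * ?S (1 - \<beta>)) / (c * ?S \<beta> + d * (u * u) * ?S (2 - \<beta>))"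
    using pos by (simp add: L1 Lx)
  \<comment> \<open>Extracting \<open>c * u\<close> from numerator and denominator produces the
    Bessel prefactors and the ratio \<open>d / c\<close>; the common factor then cancels.\<close>
  also have "c * ((v * v) * ?S (\<beta> + 1)) + d * (u * u) * ?S (1 - \<beta>)
      = (c * u) * (v * (v / u * ?S (\<beta> + 1) + d / c * (u / v * ?S (1 - \<beta>))))"
    using pos assms by (simp add: field_simps)
  also have "c * ?S \<beta> + d * (u * u) * ?S (2 - \<beta>)
      = (c * u) * (1 / u * ?S \<beta> + d / c * (u * ?S (2 - \<beta>)))"
    using pos assms by (simp add: field_simps)
  finally show ?thesis
    using pos assms by (simp add: I1 I2 I3 I4 v_def)
qed

theorem theorem2p3:
  fixes a \<beta> c\<^sub>1 c\<^sub>2 t :: real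
    and R :: "nat \<Rightarrow> real poly"
    and A b :: "nat \<Rightarrow> real"
  assumes "a > 0" and "0 < \<beta>" and "\<beta> < 2"
    and "c\<^sub>1 > 0" and "c\<^sub>2 > 0" and "t = c\<^sub>2 / c\<^sub>1"
    and "monic_orthogonal_polys a \<beta> c\<^sub>1 c\<^sub>2 R"
    and "three_term_recurrence R A b"
  shows "(\<forall>n\<ge>1. b n + b (n - 1) - real n + \<beta> = a * real n / A n) \<and>
         (\<forall>n. (A (n + 1) - a) * (A n - a) = a * (b n - real n) * (b n - real n + \<beta> - 1)) \<and>
         A 0 = 0 \<and>
         b 0 = sqrt a * ((bessel_I \<beta> (2 * sqrt a) + t * bessel_I (- \<beta>) (2 * sqrt a)) /
                         (bessel_I (\<beta> - 1) (2 * sqrt a) + t * bessel_I (1 - \<beta>) (2 * sqrt a)))"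
proof -
  let ?L = "bilattice_functional a \<beta> c\<^sub>1 c\<^sub>2"
  have \<beta>': "2 - \<beta> > 0" using assms by simp
  note lattice_facts = lattice_sum_add [OF \<open>a > 0\<close> \<open>0 < \<beta>\<close>] lattice_sum_add [OF \<open>a > 0\<close> \<beta>']
    lattice_sum_smult [OF \<open>a > 0\<close> \<open>0 < \<beta>\<close>] lattice_sum_smult [OF \<open>a > 0\<close> \<beta>']
  interpret pearson_functional ?L R A b a \<beta>
  proof
    show "?L (p + q) = ?L p + ?L q" for p q
      by (simp add: bilattice_functional_def lattice_facts algebra_simps)
    show "?L (smult c p) = c * ?L p" for c p
      by (simp add: bilattice_functional_def lattice_facts algebra_simps)
    show "?L (p * p) > 0" if "p \<noteq> 0" for p
      unfolding bilattice_functional_def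
      using assms \<beta>' that by (intro mult_pos_pos add_pos_pos lattice_sum_square_pos Gamma_real_pos) auto
    show "degree (R n) = n" "lead_coeff (R n) = 1" for n
      using assms(7) unfolding monic_orthogonal_polys_def by blast+
    show "?L (R n * R m) = 0" if "m \<noteq> n" for m n
      using assms that by (simp add: monic_orthogonal_polys_def flip: bilattice_inner_eq)
    show "three_term_recurrence R A b" "a > 0" by fact+
    show "?L ([:0, \<beta> - 1, 1:] * p) = a * ?L (shift_poly 1 p)" for p
      using assms lattice_sum_pearson [of a \<beta> 0 \<beta> p] lattice_sum_pearson [of a "2 - \<beta>" "1 - \<beta>" \<beta> p]
      by (simp add: bilattice_functional_def algebra_simps del: mult_pCons_left)
  qed
  have "b n + b (n - 1) - real n + \<beta> = a * real n / A n" if "n \<ge> 1" for n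
    using that b_sum [of "n - 1"] A_Suc_pos [of "n - 1"] by (simp add: eq_divide_eq algebra_simps)
  moreover have "b 0 = ?L [:0, 1:] / ?L 1"
  proof -
    have "R 0 = 1"
      using degree_R [of 0] lead_coeff_R [of 0] by (metis degree_eq_zeroE lead_coeff_pCons(2) one_pCons pCons_0_0)
    \<comment> \<open>Pairing the recurrence for \<open>x R_0\<close> with 1 leaves only the
      \<open>b 0\<close> term, because \<open>R_1\<close> is orthogonal to 1 and
      \<open>A 0 = 0\<close>.\<close>
    then have "?L [:0, 1:] = b 0 * ?L 1" "?L 1 > 0"
      using L_mult_x_R [of 1 0] L_R_R [of 1 0] h_pos [of 0] A_0 by (simp_all add: h_def)
    then show ?thesis by simp
  qed
  ultimately show ?thesis
    using discrete_painleve A_0 bilattice_mean [of a \<beta> c\<^sub>1 c\<^sub>2] assms by simp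
qed

end
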